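(* Assume A1 (stated in the context). Then $\mathbf{K}\cap\mathbf{B}^m_{\mathfrak{R}}\subseteq\Lambda_{k_2}\subseteq\Lambda_{k_1}\subseteq\mathbf{B}^m_{\mathfrak{R}}$ for all $k_1<k_2$ in $\mathbb{N}$, and $\mathbf{K}\cap\mathbf{B}^m_{\mathfrak{R}}=\bigcap_{k=1}^{\infty}\Lambda_k$. Consequently, if $\mathbf{K}$ is compact and $\mathfrak{R}$ is large enough that $\mathbf{K}\subset\mathbf{B}^m_{\mathfrak{R}}$, then $\mathbf{K}=\bigcap_{k=1}^{\infty}\Lambda_k$.
   Context: Problem. Let $x=(x_1,\dots,x_m)$, $y=(y_1,\dots,y_n)$, $f,g,\varphi_1,\dots,\varphi_s\in\mathbb{R}[x]$, $p\in\mathbb{R}[x,y]$, $\mathbf{Y}\subset\mathbb{R}^n$. The problem (FSIPP) is to minimize $f(x)/g(x)$ over $$\mathbf{K}:=\{x\in\mathbb{R}^m\mid \varphi_1(x)\le 0,\dots,\varphi_s(x)\le 0,\ p(x,y)\le 0\ \ \forall y\in\mathbf{Y}\}.$$ $\mathbf{S}$ is its set of optimal solutions; it is assumed throughout that $\mathbf{S}\ne\emptyset$. A polynomial $h\in\mathbb{R}[x]$ is sos-convex if there are an integer $r$ and a matrix polynomial $H\in\mathbb{R}[x]^{r\times m}$ with $\nabla^2h=H(x)^TH(x)$. Assumption A1: (i) $\mathbf{Y}\subseteq[-1,1]^n$ and $\mathbf{Y}$ is closed; (ii) $\varphi_1,\dots,\varphi_s$ and $p(\cdot,y)$ for every $y\in\mathbf{Y}$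 are sos-convex. Notation. $\mathbb{N}$ is the set of nonnegative integers. $\mathbb{R}[x]_k$, $\mathbb{R}[y]_k$: polynomials of degree at most $k$; $A^*$ is the space of linear functionals on $A$. $\Sigma^2_k[x]$ (resp. $\Sigma^2_k[y]$) is the set of polynomials of degree at most $2k$ in $x$ (resp. $y$) that are sums of squares of polynomials. $d_y:=\deg_y p(x,y)$, and $\mathbf{d}:=\lceil\max\{\deg f,\deg g,\deg\varphi_1,\dots,\deg\varphi_s,\deg_x p(x,y)\}/2\rceil$ (with $\mathbf{d}\ge1$). For $\mathscr{L}\in(\mathbb{R}[x]_{2\mathbf{d}})^*$, $\mathscr{L}(x):=(\mathscr{L}(x_1),\dots,\mathscr{L}(x_m))\in\mathbb{R}^m$, and $\mathscr{L}(p(x,y))\in\mathbb{R}[y]$ is obtained by applying $\mathscr{L}$ to $p$ viewed as a polynomial in $x$ with coefficients in $\mathbb{R}[y]$. $\mathbf{B}^m_{\mathfrak{R}}$ is the closed Euclidean ball of radius $\mathfrak{R}$ centered at the origin of $\mathbb{R}^m$. $\nu$ is a fixed finite Borel measure with support exactly $\mathbf{Y}$, and for $k\in\mathbb{N}$ $$\mathcal{P}^k(\mathbf{Y}):=\Big\{\psi\in\mathbb{R}[y]_{d_y}\ \Big|\ \int_{\mathbf{Y}}\psi\,\sigma\,d\nu\ge0\ \ \forall\sigma\in\Sigma^2_k[y]\Big\}.$$ Fixed constants $\mathfrak{R}>0$ and $g^{\star}>0$ are such that $\|u^{\star}\|\le\mathfrak{R}$ and $g(u^{\star})\ge g^{\star}$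 for some $u^{\star}\in\mathbf{S}$. For $k\in\mathbb{N}$, $\Lambda_k\subset\mathbb{R}^m$ is the set of all points $\mathscr{L}(x)$ where $\mathscr{L}\in(\mathbb{R}[x]_{2\mathbf{d}})^*$ satisfies: $\mathscr{L}(\sigma_0)\ge0$ for all $\sigma_0\in\Sigma^2_{\mathbf{d}}[x]$; $\mathscr{L}((\mathfrak{R}^2-\|x\|^2)\sigma)\ge0$ for all $\sigma\in\Sigma^2_{\mathbf{d}-1}[x]$; $-\mathscr{L}(p(x,y))\in\mathcal{P}^k(\mathbf{Y})$; $\mathscr{L}(1)=1$; and $\mathscr{L}(\varphi_j)\le0$ for $j=1,\dots,s$. *)

theory Defs
  imports "HOL-Analysis.Analysis" "HOL-Library.Poly_Mapping"
begin

text \<open>Multivariate real polynomials are finitely supported coefficient functions on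
  exponent vectors. The multiplication of \<^typ>\<open>'a \<Rightarrow>\<^sub>0 'b\<close> in \<^theory>\<open>HOL-Library.Poly_Mapping\<close>
  is convolution, that is, the product of polynomials.\<close>

type_synonym 'v monom = "'v \<Rightarrow>\<^sub>0 nat"
type_synonym 'v rpoly = "'v monom \<Rightarrow>\<^sub>0 real"

text \<open>The value of a bivariate polynomial at \<open>(\<alpha>, \<beta>)\<close> is the coefficient of
  $x^\alpha y^\beta$.\<close>

type_synonym ('m, 'n) rpoly2 = "('m monom \<times> 'n monom) \<Rightarrow>\<^sub>0 real"

definition monom_deg :: "('v::finite) monom \<Rightarrow> nat" where
  "monom_deg \<alpha> = (\<Sum>i\<in>UNIV. Poly_Mapping.lookup \<alpha> i)"

definition monom_eval :: "('v::finite) monom \<Rightarrow> real ^ 'v \<Rightarrow> real" where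
  "monom_eval \<alpha> x = (\<Prod>i\<in>UNIV. (x $ i) ^ Poly_Mapping.lookup \<alpha> i)"

definition const :: "real \<Rightarrow> 'v rpoly" where
  "const c = Poly_Mapping.single 0 c"

definition var :: "'v \<Rightarrow> 'v rpoly" where
  "var i = Poly_Mapping.single (Poly_Mapping.single i 1) 1"

definition eval :: "('v::finite) rpoly \<Rightarrow> real ^ 'v \<Rightarrow> real" where
  "eval q x = (\<Sum>\<alpha>\<in>Poly_Mapping.keys q. Poly_Mapping.lookup q \<alpha> * monom_eval \<alpha> x)"

text \<open>The zero polynomial gets degree 0.\<close>

definition deg :: "('v::finite) rpoly \<Rightarrow> nat" where
  "deg q = Max (insert 0 (monom_deg ` Poly_Mapping.keys q))"

definition deg_x :: "('m::finite, 'n::finite) rpoly2 \<Rightarrow> nat" where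
  "deg_x p = Max (insert 0 ((\<lambda>(\<alpha>, \<beta>). monom_deg \<alpha>) ` Poly_Mapping.keys p))"

definition deg_y :: "('m::finite, 'n::finite) rpoly2 \<Rightarrow> nat" where
  "deg_y p = Max (insert 0 ((\<lambda>(\<alpha>, \<beta>). monom_deg \<beta>) ` Poly_Mapping.keys p))"

definition polys_le :: "nat \<Rightarrow> ('v::finite) rpoly set" where
  "polys_le k = {q. deg q \<le> k}"

text \<open>The polynomial \<open>p(\<cdot>, y)\<close> in \<open>x\<close>, for a fixed point \<open>y\<close>.\<close>

definition at_y :: "('m::finite, 'n::finite) rpoly2 \<Rightarrow> real ^ 'n \<Rightarrow> 'm rpoly" where
  "at_y p y = (\<Sum>(\<alpha>, \<beta>)\<in>Poly_Mapping.keys p.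
     Poly_Mapping.single \<alpha> (Poly_Mapping.lookup p (\<alpha>, \<beta>) * monom_eval \<beta> y))"

text \<open>The polynomial \<open>L(p(x, y))\<close> in \<open>y\<close>, with \<open>L\<close> acting on the \<open>x\<close>-monomials.\<close>

definition apply_x :: "('m rpoly \<Rightarrow> real) \<Rightarrow> ('m::finite, 'n::finite) rpoly2 \<Rightarrow> 'n rpoly" where
  "apply_x L p = (\<Sum>(\<alpha>, \<beta>)\<in>Poly_Mapping.keys p.
     Poly_Mapping.single \<beta> (Poly_Mapping.lookup p (\<alpha>, \<beta>) * L (Poly_Mapping.single \<alpha> 1)))"

text \<open>Formal partial derivative. A monomial not containing the \<open>i\<close>-th variable contributes
  with coefficient 0, so the truncated subtraction of exponents is harmless.\<close>

definition partial :: "'v \<Rightarrow> 'v rpoly \<Rightarrow> 'v rpoly" where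
  "partial i q = (\<Sum>\<alpha>\<in>Poly_Mapping.keys q.
     Poly_Mapping.single (\<alpha> - Poly_Mapping.single i 1)
       (real (Poly_Mapping.lookup \<alpha> i) * Poly_Mapping.lookup q \<alpha>))"

text \<open>The Hessian factors as $H^T H$, with \<open>H\<close> an \<open>r \<times> m\<close> matrix polynomial with rows
  indexed by \<open>{..<r}\<close>.\<close>

definition sos_convex :: "('v::finite) rpoly \<Rightarrow> bool" where
  "sos_convex h \<longleftrightarrow> (\<exists>(r::nat) (H :: nat \<Rightarrow> 'v \<Rightarrow> 'v rpoly).
     \<forall>i j. partial i (partial j h) = (\<Sum>l<r. H l i * H l j))"

definition Sigma2 :: "nat \<Rightarrow> ('v::finite) rpoly set" where
  "Sigma2 k = {\<sigma>. deg \<sigma> \<le> 2 * k \<and> (\<exists>(r::nat) (q :: nat \<Rightarrow> 'v rpoly). \<sigma> = (\<Sum>l<r. (q l)\<^sup>2))}"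

text \<open>Linear functionals on \<open>polys_le k\<close>, represented by total functions whose values outside
  \<open>polys_le k\<close> are arbitrary.\<close>

definition functionals :: "nat \<Rightarrow> (('v::finite) rpoly \<Rightarrow> real) set" where
  "functionals k = {L.
     (\<forall>a\<in>polys_le k. \<forall>b\<in>polys_le k. L (a + b) = L a + L b) \<and>
     (\<forall>c. \<forall>a\<in>polys_le k. L (const c * a) = c * L a)}"

definition mean_point :: "(('m::finite) rpoly \<Rightarrow> real) \<Rightarrow> real ^ 'm" where
  "mean_point L = (\<chi> i. L (var i))"

definition measure_support :: "('a::topological_space) measure \<Rightarrow> 'a set" where
  "measure_support \<nu> = {y. \<forall>U. open U \<and> y \<in> U \<longrightarrow> emeasure \<nu> U > 0}"

text \<open>The constraints \<open>\<phi>\<^sub>1, \<dots>, \<phi>\<^sub>s\<close> are \<open>\<phi> 1, \<dots>, \<phi> s\<close>; other values of \<open>\<phi>\<close> are ignored.\<close>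

definition feasible ::
  "nat \<Rightarrow> (nat \<Rightarrow> 'm rpoly) \<Rightarrow> ('m::finite, 'n::finite) rpoly2 \<Rightarrow> (real ^ 'n) set \<Rightarrow> (real ^ 'm) set"
  where
  "feasible s \<phi> p Y =
     {x. (\<forall>j\<in>{1..s}. eval (\<phi> j) x \<le> 0) \<and> (\<forall>y\<in>Y. eval (at_y p y) x \<le> 0)}"

text \<open>Minimizers of \<open>f / g\<close> over the points of \<open>K\<close> where the quotient is defined; the restriction
  to \<open>g \<noteq> 0\<close> keeps the convention \<open>a / 0 = 0\<close> out of the problem.\<close>

definition optimal :: "('m::finite) rpoly \<Rightarrow> 'm rpoly \<Rightarrow> (real ^ 'm) set \<Rightarrow> (real ^ 'm) set" where
  "optimal f g K = {u \<in> K. eval g u \<noteq> 0 \<and>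
     (\<forall>x\<in>K. eval g x \<noteq> 0 \<longrightarrow> eval f u / eval g u \<le> eval f x / eval g x)}"

definition half_deg ::
  "'m rpoly \<Rightarrow> 'm rpoly \<Rightarrow> nat \<Rightarrow> (nat \<Rightarrow> 'm rpoly) \<Rightarrow> ('m::finite, 'n::finite) rpoly2 \<Rightarrow> nat" where
  "half_deg f g s \<phi> p =
     nat \<lceil>real (Max ({deg f, deg g, deg_x p} \<union> (\<lambda>j. deg (\<phi> j)) ` {1..s})) / 2\<rceil>"

text \<open>The cone $\mathcal{P}^k(\mathbf{Y})$, with the degree bound \<open>dy\<close> and the measure \<open>\<nu>\<close>
  explicit.\<close>

definition P_cone ::
  "nat \<Rightarrow> (real ^ 'n::finite) measure \<Rightarrow> (real ^ 'n) set \<Rightarrow> nat \<Rightarrow> 'n rpoly set" where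
  "P_cone dy \<nu> Y k = {\<psi> \<in> polys_le dy.
     \<forall>\<sigma>\<in>Sigma2 k. (LINT y:Y|\<nu>. eval \<psi> y * eval \<sigma> y) \<ge> 0}"

definition Lambda ::
  "nat \<Rightarrow> nat \<Rightarrow> (nat \<Rightarrow> 'm rpoly) \<Rightarrow> ('m::finite, 'n::finite) rpoly2 \<Rightarrow> (real ^ 'n) measure \<Rightarrow>
   (real ^ 'n) set \<Rightarrow> real \<Rightarrow> nat \<Rightarrow> (real ^ 'm) set" where
  "Lambda d s \<phi> p \<nu> Y R k = {mean_point L | L. L \<in> functionals (2 * d) \<and>
     (\<forall>\<sigma>\<in>Sigma2 d. L \<sigma> \<ge> 0) \<and>
     (\<forall>\<sigma>\<in>Sigma2 (d - 1). L ((const (R\<^sup>2) - (\<Sum>i\<in>UNIV. (var i)\<^sup>2)) * \<sigma>) \<ge> 0) \<and>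
     - apply_x L p \<in> P_cone (deg_y p) \<nu> Y k \<and>
     L 1 = 1 \<and>
     (\<forall>j\<in>{1..s}. L (\<phi> j) \<le> 0)}"

end

theory Submission
  imports Defs
begin

text \<open>A functional that is nonnegative on sums of squares and normalised satisfies Jensen's inequality
  for sos-convex polynomials. If \<open>x\<close> lies in every \<open>\<Lambda>\<^sub>k\<close>, represented there by \<open>L\<^sub>k\<close>, then
  \<open>- p(x, y) \<ge> - L\<^sub>k(p(\<cdot>, y))\<close> on \<open>Y\<close>, so \<open>- p(x, \<cdot>)\<close> has nonnegative integral against all sums of
  squares, and no limit of the functionals \<open>L\<^sub>k\<close> is needed. Squares of polynomials can be localized
  by the Stone-Weierstrass theorem, so \<open>- p(x, \<cdot>)\<close> is nonnegative on the support \<open>Y\<close> of the measure.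
  The other inclusions come from point evaluations and from \<open>L(x\<^sub>i)\<^sup>2 \<le> L(x\<^sub>i\<^sup>2)\<close>.\<close>

section \<open>Finitely supported functions as sums of monomials, and induction over
  polynomials\<close>

abbreviation coef :: "('a \<Rightarrow>\<^sub>0 'b::zero) \<Rightarrow> 'a \<Rightarrow> 'b" where
  "coef \<equiv> Poly_Mapping.lookup"

lemma sum_single_coef:
  fixes q :: "'a \<Rightarrow>\<^sub>0 'b::comm_monoid_add"
  shows "(\<Sum>\<alpha>\<in>Poly_Mapping.keys q. Poly_Mapping.single \<alpha> (coef q \<alpha>)) = q"
proof (rule poly_mapping_eqI)
  fix k
  have "(\<Sum>\<alpha>\<in>Poly_Mapping.keys q. coef (Poly_Mapping.single \<alpha> (coef q \<alpha>)) k)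
      = (\<Sum>\<alpha>\<in>Poly_Mapping.keys q. if \<alpha> = k then coef q \<alpha> else 0)"
    by (rule sum.cong) (auto simp: lookup_single when_def)
  also have "\<dots> = coef q k"
    by (simp add: in_keys_iff)
  finally show "coef (\<Sum>\<alpha>\<in>Poly_Mapping.keys q. Poly_Mapping.single \<alpha> (coef q \<alpha>)) k = coef q k"
    by (simp add: lookup_sum)
qed

text \<open>Since \<open>Poly_Mapping.single \<alpha> 0\<close> is zero, the \<open>single\<close>
  case also covers the empty sum.\<close>

lemma poly_mapping_single_induct [case_names single add]:
  fixes q :: "'a \<Rightarrow>\<^sub>0 'b::comm_monoid_add"
  assumes single: "\<And>\<alpha> c. P (Poly_Mapping.single \<alpha> c)"
    and add: "\<And>a b. P a \<Longrightarrow> P b \<Longrightarrow> P (a + b)"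
  shows "P q"
proof -
  have "P (\<Sum>\<alpha>\<in>A. Poly_Mapping.single \<alpha> (coef q \<alpha>))" if "finite A" for A
    using that
  proof induction
    case empty
    show ?case using single[of undefined 0] by simp
  qed (simp add: single add)
  from this[of "Poly_Mapping.keys q"] show ?thesis
    by (simp add: sum_single_coef)
qed

text \<open>Terms may cancel, so \<open>q + r\<close> can have fewer keys than the union of both key
  sets. As \<open>F \<alpha> 0 = 0\<close>, all three sums extend to that union. This makes
  constructions that sum over keys additive.\<close>

lemma sum_keys_add:
  fixes F :: "'a \<Rightarrow> 'b::comm_monoid_add \<Rightarrow> 'c::comm_monoid_add"
  assumes zero: "\<And>\<alpha>. F \<alpha> 0 = 0" and add: "\<And>\<alpha> a b. F \<alpha> (a + b) = F \<alpha> a + F \<alpha> b"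
  shows "(\<Sum>\<alpha>\<in>Poly_Mapping.keys (q + r). F \<alpha> (coef (q + r) \<alpha>))
       = (\<Sum>\<alpha>\<in>Poly_Mapping.keys q. F \<alpha> (coef q \<alpha>)) + (\<Sum>\<alpha>\<in>Poly_Mapping.keys r. F \<alpha> (coef r \<alpha>))"
proof -
  define A where "A = Poly_Mapping.keys q \<union> Poly_Mapping.keys r"
  have extend: "(\<Sum>\<alpha>\<in>Poly_Mapping.keys s. F \<alpha> (coef s \<alpha>)) = (\<Sum>\<alpha>\<in>A. F \<alpha> (coef s \<alpha>))"
    if "Poly_Mapping.keys s \<subseteq> A" for s
    using that
    by (intro sum.mono_neutral_left) (auto simp: A_def in_keys_iff zero)
  have "Poly_Mapping.keys (q + r) \<subseteq> A"
    by (auto simp: A_def in_keys_iff lookup_add)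
  then show ?thesis
    using extend[of q] extend[of r] extend[of "q + r"]
    by (simp add: A_def sum.distrib add lookup_add)
qed

lemma sum_keys_single:
  fixes F :: "'a \<Rightarrow> 'b::zero \<Rightarrow> 'c::comm_monoid_add"
  assumes "F \<alpha> 0 = 0"
  shows "(\<Sum>\<beta>\<in>Poly_Mapping.keys (Poly_Mapping.single \<alpha> c). F \<beta> (coef (Poly_Mapping.single \<alpha> c) \<beta>)) = F \<alpha> c"
  using assms by (cases "c = 0") (auto simp: keys_single)

lemma const_add: "const (a + b) = (const a + const b :: 'v rpoly)"
  by (simp add: const_def single_add)

lemma const_mult: "const (a * b) = (const a * const b :: 'v rpoly)"
  by (simp add: const_def mult_single)

lemma const_0 [simp]: "const 0 = (0 :: 'v rpoly)"
  by (simp add: const_def)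

lemma const_1 [simp]: "const 1 = (1 :: 'v rpoly)"
  by (simp add: const_def)

lemma const_mult_single: "const c * Poly_Mapping.single \<alpha> a = (Poly_Mapping.single \<alpha> (c * a) :: 'v rpoly)"
  by (simp add: const_def mult_single)

lemma var_power: "var i ^ k = (Poly_Mapping.single (Poly_Mapping.single i k) 1 :: 'v rpoly)"
  by (induction k) (simp_all add: var_def mult_single flip: single_add)

lemma prod_single_1:
  "(\<Prod>i\<in>A. Poly_Mapping.single (f i) 1) = (Poly_Mapping.single (\<Sum>i\<in>A. f i) 1 :: 'v rpoly)"
  by (induction A rule: infinite_finite_induct) (simp_all add: mult_single)

lemma monom_sum_single: "(\<Sum>i\<in>UNIV. Poly_Mapping.single i (coef \<alpha> i)) = (\<alpha> :: ('v::finite) monom)"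
proof (rule poly_mapping_eqI)
  fix k
  have "(\<Sum>i\<in>UNIV. coef (Poly_Mapping.single i (coef \<alpha> i)) k) = (\<Sum>i\<in>UNIV. if i = k then coef \<alpha> i else 0)"
    by (rule sum.cong) (auto simp: lookup_single when_def)
  then show "coef (\<Sum>i\<in>UNIV. Poly_Mapping.single i (coef \<alpha> i)) k = coef \<alpha> k"
    by (simp add: lookup_sum)
qed

lemma single_eq_const_mult_vars:
  "Poly_Mapping.single \<alpha> c = (const c * (\<Prod>i\<in>UNIV. var i ^ coef \<alpha> i) :: ('v::finite) rpoly)"
  by (simp add: var_power prod_single_1 monom_sum_single const_mult_single)

text \<open>Constants and variables generate the polynomial ring, so an identity between ring
  homomorphisms needs checking on these generators only.\<close>

lemma rpoly_induct [case_names const var add mult]: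
  fixes q :: "('v::finite) rpoly"
  assumes const: "\<And>c. P (const c)" and var: "\<And>i. P (var i)"
    and add: "\<And>a b. P a \<Longrightarrow> P b \<Longrightarrow> P (a + b)"
    and mult: "\<And>a b. P a \<Longrightarrow> P b \<Longrightarrow> P (a * b)"
  shows "P q"
proof (induction q rule: poly_mapping_single_induct)
  case (single \<alpha> c)
  have power: "P (var i ^ k)" for i k
    using const[of 1] by (induction k) (auto intro: var mult)
  have "P (\<Prod>i\<in>A. var i ^ coef \<alpha> i)" if "finite A" for A
    using that const[of 1] by induction (auto intro: power mult)
  then show ?case
    by (simp add: single_eq_const_mult_vars const mult)
qed (fact add)

subsection \<open>Substitution\<close>

text \<open>Evaluation at a point and substitution of polynomials are both instances of
  \<open>ext\<close>, with scalars mapped identically to the reals or by \<open>const\<close> to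
  polynomials. The homomorphism laws are thus proved once.\<close>

locale scalar_hom =
  fixes \<kappa> :: "real \<Rightarrow> 'a::comm_ring_1"
  assumes zero: "\<kappa> 0 = 0" and one: "\<kappa> 1 = 1"
    and add: "\<kappa> (a + b) = \<kappa> a + \<kappa> b" and mult: "\<kappa> (a * b) = \<kappa> a * \<kappa> b"
begin

definition ext :: "('v::finite \<Rightarrow> 'a) \<Rightarrow> 'v rpoly \<Rightarrow> 'a" where
  "ext x q = (\<Sum>\<alpha>\<in>Poly_Mapping.keys q. \<kappa> (coef q \<alpha>) * (\<Prod>i\<in>UNIV. x i ^ coef \<alpha> i))"

lemma ext_add: "ext x (q + r) = ext x q + ext x r"
  unfolding ext_def by (rule sum_keys_add) (simp_all add: zero add distrib_right)

lemma ext_single: "ext x (Poly_Mapping.single \<alpha> c) = \<kappa> c * (\<Prod>i\<in>UNIV. x i ^ coef \<alpha> i)"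
  unfolding ext_def by (rule sum_keys_single) (simp add: zero)

lemma ext_mult: "ext x (q * r) = ext x q * ext x r"
proof (induction q rule: poly_mapping_single_induct)
  case (single \<alpha> a)
  show ?case
  proof (induction r rule: poly_mapping_single_induct)
    case (single \<beta> b)
    show ?case
      by (simp add: ext_single mult_single mult lookup_add power_add prod.distrib)
  qed (simp add: ext_add distrib_left)
qed (simp add: ext_add distrib_right)

lemma ext_const: "ext x (const c) = \<kappa> c"
  by (simp add: const_def ext_single)

lemma ext_0: "ext x 0 = 0"
  by (simp add: ext_def)

lemma ext_1: "ext x 1 = 1"
  using ext_const[of x 1] by (simp add: one)

lemma ext_var: "ext x (var i) = x i"
proof -
  have "(\<Prod>j\<in>UNIV. x j ^ coef (Poly_Mapping.single i 1) j) = (\<Prod>j\<in>UNIV. if j = i then x j else 1)"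
    by (rule prod.cong) (auto simp: lookup_single when_def)
  then show ?thesis
    by (simp add: var_def ext_single one)
qed

lemma ext_sum: "ext x (\<Sum>i\<in>A. q i) = (\<Sum>i\<in>A. ext x (q i))"
  by (induction A rule: infinite_finite_induct) (simp_all add: ext_0 ext_add)

lemma ext_power: "ext x (q ^ k) = ext x q ^ k"
  by (induction k) (simp_all add: ext_1 ext_mult)

lemma ext_minus: "ext x (- q) = - ext x q"
  using ext_add[of x q "- q"] by (simp add: ext_0 eq_neg_iff_add_eq_0 add.commute)

lemma ext_diff: "ext x (q - r) = ext x q - ext x r"
  using ext_add[of x q "- r"] by (simp add: ext_minus)

lemmas ext_simps = ext_add ext_mult ext_const ext_0 ext_1 ext_var ext_sum ext_power ext_minus ext_diff

end


interpretation eval_hom: scalar_hom "\<lambda>c. c :: real"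
  by unfold_locales auto

lemma ext_eq_eval: "eval_hom.ext (($) x) q = eval q x"
  by (simp add: eval_hom.ext_def eval_def monom_eval_def)

lemmas eval_simps = eval_hom.ext_simps[where x = "($) z" for z, unfolded ext_eq_eval]

interpretation subst: scalar_hom "const :: real \<Rightarrow> 'w rpoly"
  by unfold_locales (simp_all add: const_add const_mult)

abbreviation subst :: "('v::finite \<Rightarrow> 'w rpoly) \<Rightarrow> 'v rpoly \<Rightarrow> 'w rpoly" where
  "subst \<equiv> subst.ext"

lemma eval_subst: "eval (subst x q) z = eval q (\<chi> i. eval (x i) z)"
  by (induction q rule: rpoly_induct) (simp_all add: eval_simps subst.ext_simps)

lemma subst_subst: "subst x (subst y q) = subst (\<lambda>i. subst x (y i)) q"
  by (induction q rule: rpoly_induct) (simp_all add: subst.ext_simps)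

lemma subst_var: "subst var q = q"
  by (induction q rule: rpoly_induct) (simp_all add: subst.ext_simps)

subsection \<open>Degree\<close>

lemma deg_le_iff: "deg q \<le> k \<longleftrightarrow> (\<forall>\<alpha>. coef q \<alpha> \<noteq> 0 \<longrightarrow> monom_deg \<alpha> \<le> k)"
  by (auto simp: deg_def in_keys_iff)

lemma deg_0 [simp]: "deg 0 = 0"
  by (simp add: deg_def)

lemma deg_add_le: "deg a \<le> k \<Longrightarrow> deg b \<le> k \<Longrightarrow> deg (a + b) \<le> k"
  unfolding deg_le_iff lookup_add by (metis add.right_neutral)

lemma deg_sum_le: "(\<And>i. i \<in> A \<Longrightarrow> deg (f i) \<le> k) \<Longrightarrow> deg (\<Sum>i\<in>A. f i) \<le> k"
  by (induction A rule: infinite_finite_induct) (auto intro: deg_add_le)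

lemma deg_uminus [simp]: "deg (- q) = deg q"
  by (simp add: deg_def)

lemma monom_deg_add: "monom_deg (\<alpha> + \<beta>) = monom_deg \<alpha> + monom_deg \<beta>"
  by (simp add: monom_deg_def lookup_add sum.distrib)

lemma monom_deg_eq_0_iff: "monom_deg \<alpha> = 0 \<longleftrightarrow> \<alpha> = 0"
  by (auto simp: monom_deg_def intro: poly_mapping_eqI)

lemma monom_deg_single: "monom_deg (Poly_Mapping.single i k) = k"
  by (simp add: monom_deg_def lookup_single when_def)

lemma coef_le_monom_deg: "coef \<alpha> i \<le> monom_deg \<alpha>"
  unfolding monom_deg_def by (rule member_le_sum) auto

lemma deg_mult_le:
  assumes "deg a \<le> k" "deg b \<le> l"
  shows "deg (a * b) \<le> k + l"
  unfolding deg_le_iff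
proof (intro allI impI)
  fix \<gamma> assume "coef (a * b) \<gamma> \<noteq> 0"
  then obtain \<alpha> \<beta> where "\<gamma> = \<alpha> + \<beta>" "coef a \<alpha> \<noteq> 0" "coef b \<beta> \<noteq> 0"
    using keys_mult[of a b] by (auto simp: in_keys_iff)
  then show "monom_deg \<gamma> \<le> k + l"
    using assms by (auto simp: deg_le_iff monom_deg_add intro!: add_mono)
qed

lemma deg_single_le: "deg (Poly_Mapping.single \<alpha> c) \<le> monom_deg \<alpha>"
  by (auto simp: deg_le_iff lookup_single when_def split: if_splits)

lemma deg_const [simp]: "deg (const c) = 0"
  using deg_single_le[of 0 c] by (simp add: const_def monom_deg_def)

lemma deg_1 [simp]: "deg 1 = 0"
  using deg_const[of 1] by simp

lemma deg_var_le: "deg (var i) \<le> 1"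
  using deg_single_le[of "Poly_Mapping.single i 1" 1] by (simp add: var_def monom_deg_single)

lemma deg_power_le: "deg q \<le> k \<Longrightarrow> deg (q ^ n) \<le> n * k"
  by (induction n) (auto intro: deg_mult_le)

lemma deg_prod_le:
  "finite A \<Longrightarrow> (\<And>i. i \<in> A \<Longrightarrow> deg (f i) \<le> k i) \<Longrightarrow> deg (\<Prod>i\<in>A. f i) \<le> (\<Sum>i\<in>A. k i)"
  by (induction A rule: finite_induct) (auto intro: deg_mult_le)

text \<open>A monomial of degree k becomes a product of k factors of degree at most one.
  Translations and dilations are substitutions of this kind.\<close>

lemma deg_subst_le:
  assumes "\<And>i. deg (x i) \<le> 1"
  shows "deg (subst x q) \<le> deg q"
  unfolding subst.ext_def
proof (rule deg_sum_le)
  fix \<alpha> assume \<alpha>: "\<alpha> \<in> Poly_Mapping.keys q"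
  have "deg (\<Prod>i\<in>UNIV. x i ^ coef \<alpha> i) \<le> (\<Sum>i\<in>UNIV. coef \<alpha> i)"
    using deg_power_le[OF assms] by (intro deg_prod_le) auto
  then have "deg (const (coef q \<alpha>) * (\<Prod>i\<in>UNIV. x i ^ coef \<alpha> i)) \<le> 0 + monom_deg \<alpha>"
    by (intro deg_mult_le) (auto simp: monom_deg_def)
  also have "\<dots> \<le> deg q"
    using \<alpha> by (simp add: deg_def)
  finally show "deg (const (coef q \<alpha>) * (\<Prod>i\<in>UNIV. x i ^ coef \<alpha> i)) \<le> deg q" .
qed

subsection \<open>Derivatives\<close>

lemma partial_single:
  "partial i (Poly_Mapping.single \<alpha> c)
     = Poly_Mapping.single (\<alpha> - Poly_Mapping.single i 1) (real (coef \<alpha> i) * c)"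
  unfolding partial_def by (rule sum_keys_single) simp

lemma partial_0 [simp]: "partial i 0 = 0"
  by (simp add: partial_def)

lemma partial_add: "partial i (q + r) = partial i q + partial i r"
  unfolding partial_def by (rule sum_keys_add) (simp_all add: single_add distrib_left)

lemma monom_shift:
  "coef \<alpha> i \<noteq> 0 \<Longrightarrow> (\<alpha> - Poly_Mapping.single i 1) + \<beta> = (\<alpha> + \<beta>) - Poly_Mapping.single i (1 :: nat)"
  by (rule poly_mapping_eqI) (auto simp: lookup_add lookup_minus lookup_single when_def)

lemma partial_mult: "partial i (q * r) = partial i q * r + q * partial i r"
proof (induction q rule: poly_mapping_single_induct)
  case (single \<alpha> a)
  show ?case
  proof (induction r rule: poly_mapping_single_induct)
    case (single \<beta> b)
    \<comment> \<open>If variable i is absent from \<alpha>, truncated subtraction need not commute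
      with adding \<beta>, but then the coefficient on both sides is 0.\<close>
    have "Poly_Mapping.single (\<alpha> - Poly_Mapping.single i 1 + \<beta>) (real (coef \<alpha> i) * a * b)
        = Poly_Mapping.single (\<alpha> + \<beta> - Poly_Mapping.single i 1) (real (coef \<alpha> i) * a * b)"
      by (cases "coef \<alpha> i = 0") (simp_all add: monom_shift[simplified])
    moreover have "Poly_Mapping.single (\<alpha> + (\<beta> - Poly_Mapping.single i 1)) (a * (real (coef \<beta> i) * b))
        = Poly_Mapping.single (\<alpha> + \<beta> - Poly_Mapping.single i 1) (a * (real (coef \<beta> i) * b))"
      using monom_shift[of \<beta> i \<alpha>] by (cases "coef \<beta> i = 0") (simp_all add: add.commute)
    ultimately show ?case
      by (simp add: partial_single mult_single lookup_add ring_distribs mult.assoc mult.left_commute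
          flip: single_add)
  qed (simp add: partial_add algebra_simps)
qed (simp add: partial_add algebra_simps)

lemma partial_const [simp]: "partial i (const c) = 0"
  by (simp add: const_def partial_single)

lemma partial_var: "partial i (var j) = (if i = j then 1 else 0)"
  by (simp add: var_def partial_single lookup_single when_def)

section \<open>Translation of the variables\<close>

definition translate :: "real ^ 'v \<Rightarrow> ('v::finite) rpoly \<Rightarrow> 'v rpoly" where
  "translate u = subst (\<lambda>i. var i + const (u $ i))"

lemmas translate_simps =
  subst.ext_simps[where x = "\<lambda>i. var i + const (u $ i)" for u, folded translate_def]

lemma partial_translate: "partial i (translate u q) = translate u (partial i q)"
  by (induction q rule: rpoly_induct)
    (simp_all add: translate_simps partial_add partial_mult partial_var)

lemma translate_translate: "translate u (translate v q) = translate (u + v) q"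
  by (simp add: translate_def subst_subst subst.ext_simps const_add add.assoc)

lemma translate_0: "translate 0 q = q"
  by (simp add: translate_def subst_var)

lemma deg_translate_le: "deg (translate u q) \<le> deg q"
  unfolding translate_def by (intro deg_subst_le deg_add_le deg_var_le) simp

lemma eval_translate_0: "eval (translate u q) 0 = eval q u"
  by (simp add: translate_def eval_subst eval_simps)

section \<open>Euler's identity and dilations\<close>

lemma var_mult_partial_single:
  "var i * Poly_Mapping.single (\<alpha> - Poly_Mapping.single i 1) (real (coef \<alpha> i) * c)
     = Poly_Mapping.single \<alpha> (real (coef \<alpha> i) * c)"
proof (cases "coef \<alpha> i = 0")
  case False
  then have "Poly_Mapping.single i 1 + (\<alpha> - Poly_Mapping.single i 1) = \<alpha>"
    by (intro poly_mapping_eqI) (auto simp: lookup_add lookup_minus lookup_single when_def)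
  then show ?thesis
    by (simp add: var_def mult_single)
qed simp

lemma sum_single: "(\<Sum>i\<in>A. Poly_Mapping.single \<alpha> (f i)) = Poly_Mapping.single \<alpha> (\<Sum>i\<in>A. f i)"
  by (induction A rule: infinite_finite_induct) (simp_all add: single_add)

text \<open>Monomials are eigenvectors of each operator \<open>var i * partial i\<close>, with the
  exponent of variable i as eigenvalue; the eigenvalues add up to the degree.\<close>

lemma euler_single:
  "(\<Sum>i\<in>UNIV. var i * partial i (Poly_Mapping.single \<alpha> c))
     = Poly_Mapping.single (\<alpha> :: ('v::finite) monom) (real (monom_deg \<alpha>) * c)"
  by (simp add: partial_single var_mult_partial_single[simplified] sum_single monom_deg_def
      flip: sum_distrib_right)

text \<open>Euler's identity for homogeneous polynomials, applied twice.\<close>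

lemma coef_hessian_form:
  fixes q :: "('v::finite) rpoly"
  shows "coef (\<Sum>i\<in>UNIV. \<Sum>j\<in>UNIV. var i * var j * partial i (partial j q)) \<alpha>
       = real (monom_deg \<alpha>) * (real (monom_deg \<alpha>) - 1) * coef q \<alpha>"
proof (induction q rule: poly_mapping_single_induct)
  case (single \<beta> c)
  \<comment> \<open>Euler's identity for the j-th derivative of the monomial, whose degree is lower
    by one unless that derivative vanishes.\<close>
  have "(\<Sum>i\<in>UNIV. var i * partial i (partial j (Poly_Mapping.single \<beta> c)))
      = Poly_Mapping.single (\<beta> - Poly_Mapping.single j 1)
          (real (coef \<beta> j) * ((real (monom_deg \<beta>) - 1) * c))" for j
  proof (cases "coef \<beta> j = 0")
    case False
    then have "\<beta> = (\<beta> - Poly_Mapping.single j 1) + Poly_Mapping.single j 1"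
      by (intro poly_mapping_eqI) (auto simp: lookup_add lookup_minus lookup_single when_def)
    then have "monom_deg \<beta> = monom_deg (\<beta> - Poly_Mapping.single j 1) + 1"
      by (metis monom_deg_add monom_deg_single)
    then show ?thesis
      by (simp add: partial_single[of j] euler_single mult_ac)
  qed (simp add: partial_single)
  then have "(\<Sum>i\<in>UNIV. \<Sum>j\<in>UNIV. var i * var j * partial i (partial j (Poly_Mapping.single \<beta> c)))
      = (\<Sum>j\<in>UNIV. var j * Poly_Mapping.single (\<beta> - Poly_Mapping.single j 1)
          (real (coef \<beta> j) * ((real (monom_deg \<beta>) - 1) * c)))"
    by (subst sum.swap) (simp add: mult.assoc mult.left_commute flip: sum_distrib_left)
  also have "\<dots> = Poly_Mapping.single \<beta> (real (monom_deg \<beta>) * ((real (monom_deg \<beta>) - 1) * c))"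
    by (simp add: var_mult_partial_single[simplified] sum_single monom_deg_def flip: sum_distrib_right)
  finally show ?case
    by (simp add: lookup_single when_def)
next
  case (add a b)
  then show ?case
    by (simp add: partial_add distrib_left sum.distrib lookup_add)
qed

definition dilate :: "real \<Rightarrow> ('v::finite) rpoly \<Rightarrow> 'v rpoly" where
  "dilate t = subst (\<lambda>i. const t * var i)"

text \<open>Dilation scales each homogeneous part by a power of t, so a functional applied to a
  dilated polynomial gives a polynomial in t.\<close>

lemma coef_dilate:
  fixes q :: "('v::finite) rpoly"
  shows "coef (dilate t q) \<alpha> = t ^ monom_deg \<alpha> * coef q \<alpha>"
proof (induction q rule: poly_mapping_single_induct)
  case (single \<beta> c)
  have "const t ^ k = (const (t ^ k) :: 'v rpoly)" for k
    by (induction k) (simp_all add: const_mult)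
  moreover have "(\<Prod>i\<in>A. const (f i)) = (const (\<Prod>i\<in>A. f i) :: 'v rpoly)" for A and f :: "'v \<Rightarrow> real"
    by (induction A rule: infinite_finite_induct) (simp_all add: const_mult)
  ultimately have "dilate t (Poly_Mapping.single \<beta> c)
      = const c * (const (t ^ monom_deg \<beta>) * (\<Prod>i\<in>UNIV. var i ^ coef \<beta> i))"
    by (simp add: dilate_def subst.ext_single power_mult_distrib prod.distrib monom_deg_def power_sum)
  also have "\<dots> = Poly_Mapping.single \<beta> (t ^ monom_deg \<beta> * c)"
    by (simp add: var_power prod_single_1 monom_sum_single const_def mult_single mult.commute)
  finally show ?case
    by (simp add: lookup_single when_def)
qed (simp add: dilate_def subst.ext_add lookup_add distrib_left)


lemma dilate_sum_squares: "dilate t (\<Sum>l<r. (q l)\<^sup>2) = (\<Sum>l<r. (dilate t (q l))\<^sup>2)"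
  by (simp add: dilate_def subst.ext_simps)

lemma deg_dilate_le: "deg (dilate t q) \<le> deg q"
  unfolding dilate_def by (intro deg_subst_le order.trans[OF deg_mult_le[OF order.refl deg_var_le]]) simp

subsection \<open>Positive functionals and Jensen's inequality\<close>

lemma functionals_0:
  assumes "L \<in> functionals k"
  shows "L 0 = 0"
proof -
  have "(0 :: 'a rpoly) \<in> polys_le k"
    by (simp add: polys_le_def)
  then have "L (const 0 * 0) = 0 * L 0"
    using assms unfolding functionals_def by blast
  then show ?thesis
    by simp
qed

lemma functionals_add:
  "L \<in> functionals k \<Longrightarrow> deg a \<le> k \<Longrightarrow> deg b \<le> k \<Longrightarrow> L (a + b) = L a + L b"
  by (simp add: functionals_def polys_le_def)

lemma functionals_scale:
  "L \<in> functionals k \<Longrightarrow> deg a \<le> k \<Longrightarrow> L (const c * a) = c * L a"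
  by (simp add: functionals_def polys_le_def)

lemma functionals_sum:
  assumes "L \<in> functionals k" "\<And>i. i \<in> A \<Longrightarrow> deg (f i) \<le> k"
  shows "L (\<Sum>i\<in>A. f i) = (\<Sum>i\<in>A. L (f i))"
  using assms(2)
  by (induction A rule: infinite_finite_induct)
    (simp_all add: functionals_0[OF assms(1)] functionals_add[OF assms(1)] deg_sum_le)

lemma functionals_single:
  assumes "L \<in> functionals k" "monom_deg \<alpha> \<le> k"
  shows "L (Poly_Mapping.single \<alpha> c) = c * L (Poly_Mapping.single \<alpha> 1)"
  using functionals_scale[OF assms(1) order.trans[OF deg_single_le assms(2)], of c 1]
  by (simp add: const_mult_single)

lemma functionals_diff:
  assumes "L \<in> functionals k" "deg a \<le> k" "deg b \<le> k"
  shows "L (a - b) = L a - L b"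
  using functionals_add[of L k "a - b" b] deg_add_le[of a k "- b"] assms by simp

lemma functionals_const:
  assumes "L \<in> functionals k"
  shows "L (const c) = c * L 1"
  using functionals_scale[OF assms, of 1 c] by simp

text \<open>\<open>A\<close> may exceed the key set, so that h and its dilated second-order form can
  be expanded over the same monomials.\<close>

lemma functionals_expand:
  assumes "L \<in> functionals k" "deg q \<le> k" "finite A" "Poly_Mapping.keys q \<subseteq> A"
    and "\<And>\<alpha>. \<alpha> \<in> A \<Longrightarrow> monom_deg \<alpha> \<le> k"
  shows "L q = (\<Sum>\<alpha>\<in>A. coef q \<alpha> * L (Poly_Mapping.single \<alpha> 1))"
proof -
  have "L q = L (\<Sum>\<alpha>\<in>Poly_Mapping.keys q. Poly_Mapping.single \<alpha> (coef q \<alpha>))"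
    by (simp add: sum_single_coef)
  also have "\<dots> = (\<Sum>\<alpha>\<in>Poly_Mapping.keys q. L (Poly_Mapping.single \<alpha> (coef q \<alpha>)))"
    using assms(4,5) by (intro functionals_sum[OF assms(1)] order.trans[OF deg_single_le]) auto
  also have "\<dots> = (\<Sum>\<alpha>\<in>Poly_Mapping.keys q. coef q \<alpha> * L (Poly_Mapping.single \<alpha> 1))"
    using assms(4,5) by (intro sum.cong functionals_single[OF assms(1)]) auto
  also have "\<dots> = (\<Sum>\<alpha>\<in>A. coef q \<alpha> * L (Poly_Mapping.single \<alpha> 1))"
    using assms(3,4) by (intro sum.mono_neutral_left) (auto simp: in_keys_iff)
  finally show ?thesis .
qed

text \<open>\<open>F t\<close> is the value of \<open>L\<close> at the dilated polynomial \<open>x \<mapsto> h (t x)\<close>. The assumption makes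
  \<open>t\<^sup>2 F'' t\<close> the value of \<open>L\<close> at a dilated sum of squares, so \<open>F\<close> is convex on \<open>[0, 1]\<close>, and
  \<open>F' 0 = 0\<close> because the first moments of \<open>L\<close> vanish.\<close>

lemma jensen_centered:
  fixes h :: "('v::finite) rpoly"
  assumes L: "L \<in> functionals (2 * d)" and pos: "\<And>\<sigma>. \<sigma> \<in> Sigma2 d \<Longrightarrow> 0 \<le> L \<sigma>"
    and L1: "L 1 = 1" and Lvar: "\<And>i. L (var i) = 0"
    and deg_h: "deg h \<le> 2 * d"
    and sos: "(\<Sum>i\<in>UNIV. \<Sum>j\<in>UNIV. var i * var j * partial i (partial j h)) = (\<Sum>l<(r::nat). (q l)\<^sup>2)"
  shows "eval h 0 \<le> L h"
proof -
  define m where "m \<alpha> = coef h \<alpha> * L (Poly_Mapping.single \<alpha> 1)" for \<alpha>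
  define F where "F t = (\<Sum>\<alpha>\<in>Poly_Mapping.keys h. m \<alpha> * t ^ monom_deg \<alpha>)" for t
  \<comment> \<open>The exponents use truncated subtraction; wherever it cuts off,
    \<open>real (monom_deg \<alpha>)\<close> or \<open>real (monom_deg \<alpha> - 1)\<close>
    supplies a factor 0.\<close>
  define F' where "F' t = (\<Sum>\<alpha>\<in>Poly_Mapping.keys h. m \<alpha> * (real (monom_deg \<alpha>) * t ^ (monom_deg \<alpha> - 1)))" for t
  define F'' where "F'' t = (\<Sum>\<alpha>\<in>Poly_Mapping.keys h.
    m \<alpha> * (real (monom_deg \<alpha>) * (real (monom_deg \<alpha> - 1) * t ^ (monom_deg \<alpha> - 2))))" for t
  define G where "G = (\<Sum>l<r. (q l)\<^sup>2)"
  have deg_keys: "monom_deg \<alpha> \<le> 2 * d" if "\<alpha> \<in> Poly_Mapping.keys h" for \<alpha>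
    using that deg_h by (auto simp: deg_le_iff in_keys_iff)
  have coef_G: "coef G \<alpha> = real (monom_deg \<alpha>) * (real (monom_deg \<alpha>) - 1) * coef h \<alpha>" for \<alpha>
    unfolding G_def sos[symmetric] by (rule coef_hessian_form)
  \<comment> \<open>\<open>Sigma2 d\<close> bounds the degree of the whole sum, and this bound is
    inherited from h through \<open>coef_G\<close>.\<close>
  then have deg_G: "deg G \<le> 2 * d"
    using deg_h by (simp add: deg_le_iff)
  have F': "(F has_real_derivative F' t) (at t)" for t
    unfolding F_def F'_def by (auto intro!: derivative_eq_intros sum.cong)
  have F'': "(F' has_real_derivative F'' t) (at t)" for t
    unfolding F'_def F''_def
    by (auto intro!: derivative_eq_intros sum.cong simp: numeral_2_eq_2)
  have F''_nonneg: "0 \<le> F'' t" if "0 < t" for t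
  proof -
    have deg_D: "deg (dilate t G) \<le> 2 * d"
      using deg_dilate_le deg_G by (rule order.trans)
    then have "dilate t G \<in> Sigma2 d"
      by (auto simp: Sigma2_def G_def dilate_sum_squares)
    then have "0 \<le> L (dilate t G)"
      by (rule pos)
    also have "L (dilate t G) = (\<Sum>\<alpha>\<in>Poly_Mapping.keys h. coef (dilate t G) \<alpha> * L (Poly_Mapping.single \<alpha> 1))"
      by (rule functionals_expand[OF L deg_D])
        (auto simp: in_keys_iff coef_dilate coef_G intro: deg_keys)
    \<comment> \<open>Compared monomial by monomial: in degrees 0 and 1 both sides vanish, and in
      higher degrees the powers of t agree.\<close>
    also have "\<dots> = t\<^sup>2 * F'' t"
      unfolding F''_def sum_distrib_left
    proof (rule sum.cong)
      fix \<alpha> :: "'v monom"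
      consider "monom_deg \<alpha> = 0" | "monom_deg \<alpha> = 1" | k where "monom_deg \<alpha> = k + 2"
        by (metis One_nat_def add_2_eq_Suc' not0_implies_Suc)
      then show "coef (dilate t G) \<alpha> * L (Poly_Mapping.single \<alpha> 1) = t\<^sup>2 *
          (m \<alpha> * (real (monom_deg \<alpha>) * (real (monom_deg \<alpha> - 1) * t ^ (monom_deg \<alpha> - 2))))"
        by cases (simp_all add: coef_dilate coef_G m_def power_add power2_eq_square)
    qed simp
    finally show ?thesis
      using \<open>0 < t\<close> by (simp add: zero_le_mult_iff)
  qed
  \<comment> \<open>As \<open>0 ^ 0 = 1\<close>, only monomials of degree 1 could contribute at 0.
    These are the variables, on which L vanishes.\<close>
  have term_0: "m \<alpha> * (real (monom_deg \<alpha>) * 0 ^ (monom_deg \<alpha> - 1)) = 0" for \<alpha>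
  proof (cases "monom_deg \<alpha> = 1")
    case True
    then obtain i where "coef \<alpha> i \<noteq> 0"
      by (metis monom_deg_eq_0_iff one_neq_zero poly_mapping_eqI lookup_zero)
    then have "coef \<alpha> i = 1"
      using True coef_le_monom_deg[of \<alpha> i] by simp
    then have "\<alpha> = (\<alpha> - Poly_Mapping.single i 1) + Poly_Mapping.single i 1"
      by (intro poly_mapping_eqI) (auto simp: lookup_add lookup_minus lookup_single when_def)
    then have "monom_deg (\<alpha> - Poly_Mapping.single i 1) = 0"
      using True by (metis add_cancel_left_left monom_deg_add monom_deg_single)
    then have "\<alpha> = Poly_Mapping.single i 1"
      using \<open>\<alpha> = _ + _\<close> by (simp add: monom_deg_eq_0_iff)
    then show ?thesis
      using Lvar[of i] by (simp add: m_def var_def)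
  next
    case False
    then show ?thesis
      by (cases "monom_deg \<alpha>") auto
  qed
  have F'_0: "F' 0 = 0"
    unfolding F'_def by (simp only: term_0 sum.neutral_const)
  have F'_nonneg: "0 \<le> F' t" if "0 \<le> t" for t
  proof -
    have "F' 0 \<le> F' t"
    proof (rule DERIV_nonneg_imp_increasing_open[OF that])
      show "continuous_on {0..t} F'"
        using F'' by (blast intro: continuous_at_imp_continuous_on DERIV_isCont)
    qed (use F'' F''_nonneg in blast)
    then show ?thesis
      by (simp add: F'_0)
  qed
  \<comment> \<open>F is nondecreasing on the unit interval, and its end values are h(0), by
    \<open>L 1 = 1\<close>, and \<open>L h\<close>.\<close>
  have "F 0 \<le> F 1"
    using F' F'_nonneg by (intro DERIV_nonneg_imp_nondecreasing[OF zero_le_one]) blast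
  also have "F 1 = L h"
    using functionals_expand[OF L deg_h, of "Poly_Mapping.keys h"] deg_keys by (simp add: F_def m_def)
  also have "F 0 = eval h 0"
    unfolding F_def eval_def
  proof (rule sum.cong)
    fix \<alpha> :: "'v monom"
    show "m \<alpha> * 0 ^ monom_deg \<alpha> = coef h \<alpha> * monom_eval \<alpha> 0"
    proof (cases "\<alpha> = 0")
      case False
      then obtain i where "coef \<alpha> i \<noteq> 0"
        by (metis poly_mapping_eqI lookup_zero)
      then have "monom_eval \<alpha> 0 = 0"
        by (auto simp: monom_eval_def intro!: prod_zero)
      then show ?thesis
        using False monom_deg_eq_0_iff[of \<alpha>] by simp
    qed (simp add: m_def monom_eval_def L1 monom_deg_def)
  qed simp
  finally show ?thesis .
qed

text \<open>Moves the mean point u of L to the origin. The functional \<open>M\<close>, which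
  translates by -u before applying L, has vanishing first moments; \<open>translate u h\<close>
  takes the value h(u) at 0, and \<open>M (translate u h) = L h\<close>. The centered case then
  applies.\<close>

lemma jensen_sos_convex:
  fixes h :: "('v::finite) rpoly"
  assumes L: "L \<in> functionals (2 * d)" and pos: "\<And>\<sigma>. \<sigma> \<in> Sigma2 d \<Longrightarrow> 0 \<le> L \<sigma>"
    and L1: "L 1 = 1" and d: "d \<ge> 1"
    and deg_h: "deg h \<le> 2 * d" and h: "sos_convex h"
  shows "eval h (mean_point L) \<le> L h"
proof -
  define u where "u = mean_point L"
  define M where "M q = L (translate (- u) q)" for q
  obtain r :: nat and H where H: "\<And>i j. partial i (partial j h) = (\<Sum>l<r. H l i * H l j)"
    using h unfolding sos_convex_def by blast
  have deg_T: "deg (translate v q) \<le> k" if "deg q \<le> k" for v q and k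
    using deg_translate_le that by (rule order.trans)
  have deg_var: "deg (var i :: 'v rpoly) \<le> 2 * d" for i
    using deg_var_le[of i] d by linarith
  have M: "M \<in> functionals (2 * d)"
    by (simp add: functionals_def polys_le_def M_def translate_simps
        functionals_add[OF L deg_T deg_T] functionals_scale[OF L deg_T])
  \<comment> \<open>Translation is a ring homomorphism that does not raise degrees, so it maps
    \<open>Sigma2 d\<close> into itself.\<close>
  have "0 \<le> M \<sigma>" if "\<sigma> \<in> Sigma2 d" for \<sigma>
    unfolding M_def
  proof (rule pos)
    show "translate (- u) \<sigma> \<in> Sigma2 d"
      using that deg_T unfolding Sigma2_def by (fastforce simp only: mem_Collect_eq translate_simps)
  qed
  moreover have "M 1 = 1"
    by (simp add: M_def translate_simps L1)
  moreover have "M (var i) = 0" for i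
  proof -
    have "M (var i) = L (var i) + L (const (- u $ i))"
      by (simp add: M_def translate_simps functionals_add[OF L] deg_var)
    also have "\<dots> = 0"
      using functionals_const[OF L, of "- u $ i"] by (simp add: L1 u_def mean_point_def)
    finally show ?thesis .
  qed
  \<comment> \<open>The quadratic form of H^T H at x is the squared norm of H x, here with the
    entries of H translated.\<close>
  moreover have "(\<Sum>i\<in>UNIV. \<Sum>j\<in>UNIV. var i * var j * partial i (partial j (translate u h)))
      = (\<Sum>l<r. (\<Sum>i\<in>UNIV. var i * translate u (H l i))\<^sup>2)"
  proof -
    have "(\<Sum>i\<in>UNIV. \<Sum>j\<in>UNIV. var i * var j * partial i (partial j (translate u h)))
        = (\<Sum>i\<in>UNIV. \<Sum>j\<in>UNIV. \<Sum>l<r. (var i * translate u (H l i)) * (var j * translate u (H l j)))"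
      by (simp add: partial_translate H translate_simps sum_distrib_left mult_ac)
    also have "\<dots> = (\<Sum>i\<in>UNIV. \<Sum>l<r. \<Sum>j\<in>UNIV. (var i * translate u (H l i)) * (var j * translate u (H l j)))"
      by (intro sum.cong sum.swap) simp
    also have "\<dots> = (\<Sum>l<r. \<Sum>i\<in>UNIV. \<Sum>j\<in>UNIV. (var i * translate u (H l i)) * (var j * translate u (H l j)))"
      by (rule sum.swap)
    also have "\<dots> = (\<Sum>l<r. (\<Sum>i\<in>UNIV. var i * translate u (H l i))\<^sup>2)"
      by (simp add: power2_eq_square sum_product)
    finally show ?thesis .
  qed
  ultimately have "eval (translate u h) 0 \<le> M (translate u h)"
    by (intro jensen_centered[OF M] deg_T deg_h)
  then show ?thesis
    by (simp add: eval_translate_0 M_def translate_translate translate_0 flip: u_def)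
qed

subsection \<open>Localization of the measure\<close>

text \<open>The complement of the support is the union of all open null sets. By Lindelof countably
  many of them cover it, so it is null, and intersecting with the support costs U no
  measure.\<close>

lemma emeasure_Int_support_pos:
  fixes \<nu> :: "('a::second_countable_topology) measure"
  assumes sets: "sets \<nu> = sets borel" and U: "open U" "y \<in> U" and y: "y \<in> measure_support \<nu>"
  shows "0 < emeasure \<nu> (U \<inter> measure_support \<nu>)"
proof -
  define S where "S = measure_support \<nu>"
  define \<F> where "\<F> = {V. open V \<and> emeasure \<nu> V = 0}"
  obtain \<F>' where \<F>': "\<F>' \<subseteq> \<F>" "countable \<F>'" "\<Union>\<F>' = \<Union>\<F>"
    using Lindelof[of \<F>] by (auto simp: \<F>_def)
  have "(\<Union>V\<in>\<F>'. V) \<in> null_sets \<nu>"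
    using \<F>' by (intro null_sets_UN') (auto simp: \<F>_def null_sets_def sets)
  moreover have compl: "- S = \<Union>\<F>"
    by (auto simp: S_def \<F>_def measure_support_def)
  ultimately have null: "- S \<in> null_sets \<nu>"
    using \<F>' by simp
  have "open (- S)"
    unfolding compl by (rule open_Union) (auto simp: \<F>_def)
  then have S: "S \<in> sets \<nu>"
    using sets by (simp add: closed_def borel_closed)
  have "0 < emeasure \<nu> U"
    using y U by (auto simp: measure_support_def)
  also have "emeasure \<nu> U \<le> emeasure \<nu> (U \<inter> S \<union> - S)"
    using null S U sets by (intro emeasure_mono) auto
  also have "\<dots> = emeasure \<nu> (U \<inter> S)"
    using null S U sets by (intro emeasure_Un_null_set) auto
  finally show ?thesis
    by (simp add: S_def)
qed

lemma set_integrable_compact: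
  fixes f :: "'a::euclidean_space \<Rightarrow> real"
  assumes "finite_measure \<nu>" "sets \<nu> = sets borel" "compact Y" "continuous_on Y f"
  shows "set_integrable \<nu> Y f"
proof -
  interpret finite_measure \<nu> by fact
  obtain B where "\<forall>z\<in>f ` Y. norm z \<le> B"
    using compact_continuous_image[OF assms(4,3)] compact_imp_bounded bounded_iff by metis
  \<comment> \<open>The maximum with 0 covers points outside Y, where the integrand is 0 although
    \<open>B\<close> may be negative if Y is empty.\<close>
  then have "norm (indicator Y y *\<^sub>R f y) \<le> max B 0" for y
    by (auto simp: indicator_def)
  moreover have "(\<lambda>y. indicator Y y *\<^sub>R f y) \<in> borel_measurable borel"
    using assms(3,4)
    by (intro borel_measurable_continuous_on_indicator borel_closed compact_imp_closed)
  ultimately show ?thesis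
    unfolding set_integrable_def using assms(2)
    by (intro integrable_const_bound[where B = "max B 0"]) (auto cong: measurable_cong_sets)
qed

lemma continuous_on_eval: "continuous_on A (eval q)"
  by (induction q rule: rpoly_induct) (auto simp: eval_simps intro!: continuous_intros)

text \<open>Turns the approximants supplied by Stone-Weierstrass into coefficient polynomials. A
  linear function is expanded in the standard basis.\<close>

lemma real_polynomial_function_eval:
  fixes f :: "real ^ ('v::finite) \<Rightarrow> real"
  assumes "real_polynomial_function f"
  shows "\<exists>q. f = eval q"
  using assms
proof induction
  case (linear f)
  then interpret f: bounded_linear f .
  have expand: "f x = (\<Sum>i\<in>UNIV. x $ i * f (axis i 1))" for x
    by (subst basis_expansion[symmetric]) (simp only: f.sum f.scaleR scalar_mult_eq_scaleR real_scaleR_def)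
  have "f = eval (\<Sum>i\<in>UNIV. var i * const (f (axis i 1)))"
    by (rule ext, subst expand) (simp add: eval_simps)
  then show ?case ..
next
  case (const c)
  then show ?case by (intro exI[of _ "const c"] ext) (simp add: eval_simps)
next
  case (add f g)
  then show ?case by (metis eval_simps(1))
next
  case (mult f g)
  then show ?case by (metis eval_simps(2))
qed

text \<open>Squares of polynomials \<open>q\<close> close to the negative part \<open>h\<close> of \<open>Q\<close> are enough, as
  \<open>Q h\<^sup>2 = - h\<^sup>3\<close>.\<close>

lemma nonneg_on_support:
  fixes Q :: "real ^ ('v::finite) \<Rightarrow> real"
  assumes fin: "finite_measure \<nu>" and sets: "sets \<nu> = sets borel" and supp: "measure_support \<nu> = Y"
    and Y: "compact Y" and Q: "continuous_on UNIV Q"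
    and sq: "\<And>q. 0 \<le> (LINT y:Y|\<nu>. Q y * (eval q y)\<^sup>2)"
    and y0: "y0 \<in> Y"
  shows "0 \<le> Q y0"
proof (rule ccontr)
  interpret finite_measure \<nu> by fact
  assume neg: "\<not> 0 \<le> Q y0"
  define h where "h y = max 0 (- Q y)" for y
  have cont_Q: "continuous_on Y Q"
    using Q continuous_on_subset by blast
  then have cont_h: "continuous_on Y h"
    unfolding h_def by (intro continuous_intros)
  note integrable = set_integrable_compact[OF fin sets Y]
  have Y_sets: "Y \<in> sets \<nu>"
    using sets Y by (auto intro: borel_closed compact_imp_closed)
  define I where "I = (LINT y:Y|\<nu>. h y ^ 3)"
  \<comment> \<open>Half of \<open>- Q y0\<close>, so that h exceeds c on the neighbourhood
    \<open>U\<close> of \<open>y0\<close>. Hence \<open>I\<close> is at least \<open>c ^ 3\<close>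
    times the positive measure of \<open>U \<inter> Y\<close>.\<close>
  define c where "c = - Q y0 / 2"
  define U where "U = {y. Q y < - c}"
  have "open U"
    unfolding U_def using Q by (intro open_Collect_less continuous_intros)
  moreover have "y0 \<in> U"
    using neg by (simp add: U_def c_def)
  ultimately have "0 < emeasure \<nu> (U \<inter> Y)"
    using emeasure_Int_support_pos[OF sets] y0 by (simp add: supp)
  then have "0 < measure \<nu> (U \<inter> Y)"
    by (simp add: emeasure_eq_measure)
  moreover have "0 < c"
    using neg by (simp add: c_def)
  ultimately have "0 < c ^ 3 * measure \<nu> (U \<inter> Y)"
    by simp
  also have UY: "U \<inter> Y \<in> sets \<nu>"
    using \<open>open U\<close> Y_sets sets by auto
  have "c ^ 3 * measure \<nu> (U \<inter> Y) = (LINT y|\<nu>. indicator (U \<inter> Y) y * c ^ 3)"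
    using UY by simp
  also have "\<dots> \<le> I"
    unfolding I_def set_lebesgue_integral_def
  proof (rule integral_mono)
    show "integrable \<nu> (\<lambda>y. indicator Y y *\<^sub>R h y ^ 3)"
      using integrable[of "\<lambda>y. h y ^ 3"] cont_h by (simp add: set_integrable_def continuous_intros)
    show "indicator (U \<inter> Y) y * c ^ 3 \<le> indicator Y y *\<^sub>R h y ^ 3" for y
    proof (cases "y \<in> U")
      case True
      then have "c ^ 3 \<le> h y ^ 3"
        using \<open>0 < c\<close> by (intro power_mono) (auto simp: U_def h_def)
      then show ?thesis
        using True by (auto simp: indicator_def)
    qed (simp add: indicator_def h_def)
    show "integrable \<nu> (\<lambda>y. indicator (U \<inter> Y) y * c ^ 3)"
      using UY by (intro integrable_mult_left integrable_real_indicator) (simp_all add: less_top[symmetric])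
  qed
  finally have I_pos: "0 < I" .
  obtain B where "\<forall>z\<in>Q ` Y. norm z \<le> B"
    using compact_continuous_image[OF cont_Q Y] compact_imp_bounded bounded_iff by metis
  then have B: "\<bar>Q y\<bar> \<le> B" if "y \<in> Y" for y
    using that by simp
  then have B0: "0 \<le> B"
    using y0 by (meson abs_ge_zero order.trans)
  \<comment> \<open>\<open>C * e\<close> will be the integrated error of replacing h by a polynomial
    e-close to it on Y.\<close>
  define C where "C = B * (2 * B + 1) * measure \<nu> Y"
  have C0: "0 \<le> C"
    by (simp add: C_def B0)
  \<comment> \<open>\<open>e \<le> 1\<close> keeps the sum of h and its approximant within 2 * B +
    1. The denominator C + 1 is positive even for C = 0 and makes the error \<open>C * e\<close>
    smaller than \<open>I\<close>.\<close>
  define e where "e = min 1 (I / (C + 1))"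
  have e: "0 < e" "e \<le> 1"
    using I_pos C0 by (auto simp: e_def)
  obtain f where f: "real_polynomial_function f" "\<And>y. y \<in> Y \<Longrightarrow> \<bar>h y - f y\<bar> < e"
    using Stone_Weierstrass_real_polynomial_function[OF Y cont_h e(1)] by blast
  obtain q where q: "\<And>y. y \<in> Y \<Longrightarrow> \<bar>h y - eval q y\<bar> \<le> e"
    using real_polynomial_function_eval[OF f(1)] f(2) by (metis less_imp_le)
  have le: "Q y * (eval q y)\<^sup>2 \<le> B * (2 * B + 1) * e - h y ^ 3" if "y \<in> Y" for y
  proof -
    have h: "0 \<le> h y" "h y \<le> B" and Qh: "Q y * (h y)\<^sup>2 = - (h y ^ 3)"
      using B[OF that] by (auto simp: h_def max_def power2_eq_square power3_eq_cube)
    \<comment> \<open>The difference of squares splits into a factor of size at most e and a bounded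
      factor.\<close>
    have "\<bar>(eval q y)\<^sup>2 - (h y)\<^sup>2\<bar> = \<bar>h y - eval q y\<bar> * \<bar>h y + eval q y\<bar>"
      by (simp add: power2_eq_square algebra_simps flip: abs_mult)
    also have "\<dots> \<le> e * (2 * B + 1)"
      using q[OF that] h e B0 by (intro mult_mono) auto
    finally have "\<bar>Q y * ((eval q y)\<^sup>2 - (h y)\<^sup>2)\<bar> \<le> B * (e * (2 * B + 1))"
      unfolding abs_mult using B[OF that] B0 by (intro mult_mono) auto
    then show ?thesis
      using Qh by (simp add: algebra_simps)
  qed
  have "0 \<le> (LINT y:Y|\<nu>. Q y * (eval q y)\<^sup>2)"
    by (rule sq)
  also have "\<dots> \<le> (LINT y:Y|\<nu>. B * (2 * B + 1) * e - h y ^ 3)"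
    using cont_Q cont_h continuous_on_eval le
    by (intro set_integral_mono integrable continuous_intros) auto
  also have "\<dots> = (LINT y:Y|\<nu>. B * (2 * B + 1) * e) - I"
    unfolding I_def using cont_h by (intro set_integral_diff integrable continuous_intros)
  also have "(LINT y:Y|\<nu>. B * (2 * B + 1) * e) = C * e"
    using Y_sets by (simp add: set_lebesgue_integral_def C_def)
  finally have "I \<le> C * e"
    by simp
  also have "\<dots> \<le> C * (I / (C + 1))"
    using C0 by (intro mult_left_mono) (auto simp: e_def)
  also have "\<dots> < I"
    using I_pos C0 by (simp add: field_simps)
  finally show False
    by simp
qed

subsection \<open>The outer approximations\<close>

lemma power2_norm_vec: "(norm x)\<^sup>2 = (\<Sum>i\<in>UNIV. (x $ i)\<^sup>2)" for x :: "real ^ ('n::finite)"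
  unfolding power2_norm_eq_inner inner_vec_def by (simp add: power2_eq_square)

lemma eval_single: "eval (Poly_Mapping.single \<alpha> c) x = c * monom_eval \<alpha> x"
  using eval_hom.ext_single[of "($) x" \<alpha> c] by (simp add: ext_eq_eval monom_eval_def)

lemma deg_x_keys: "z \<in> Poly_Mapping.keys p \<Longrightarrow> monom_deg (fst z) \<le> deg_x p"
  by (auto simp: deg_x_def split_def)

lemma deg_y_keys: "z \<in> Poly_Mapping.keys p \<Longrightarrow> monom_deg (snd z) \<le> deg_y p"
  by (auto simp: deg_y_def split_def)

lemma deg_at_y_le: "deg (at_y p y) \<le> deg_x p"
  unfolding at_y_def split_def
  by (intro deg_sum_le order.trans[OF deg_single_le] deg_x_keys)

lemma deg_apply_x_le: "deg (apply_x L p) \<le> deg_y p"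
  unfolding apply_x_def split_def
  by (intro deg_sum_le order.trans[OF deg_single_le] deg_y_keys)

text \<open>Lets the cone condition on the polynomial \<open>apply_x L p\<close> be read pointwise
  in y. The degree bound places all x-monomials of p where L is linear.\<close>

lemma eval_apply_x:
  assumes "L \<in> functionals k" "deg_x p \<le> k"
  shows "eval (apply_x L p) y = L (at_y p y)"
proof -
  have deg: "monom_deg (fst z) \<le> k" if "z \<in> Poly_Mapping.keys p" for z
    using deg_x_keys[OF that] assms(2) by simp
  have "L (at_y p y) = (\<Sum>z\<in>Poly_Mapping.keys p.
      L (Poly_Mapping.single (fst z) (coef p (fst z, snd z) * monom_eval (snd z) y)))"
    unfolding at_y_def split_def
    by (intro functionals_sum[OF assms(1)] order.trans[OF deg_single_le] deg)
  also have "\<dots> = (\<Sum>z\<in>Poly_Mapping.keys p.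
      (coef p (fst z, snd z) * monom_eval (snd z) y) * L (Poly_Mapping.single (fst z) 1))"
    by (intro sum.cong functionals_single[OF assms(1)] deg) auto
  finally show ?thesis
    unfolding apply_x_def split_def by (simp add: eval_simps eval_single mult_ac)
qed

lemma eval_functional: "(\<lambda>q. eval q x) \<in> functionals k"
  by (simp add: functionals_def eval_simps)

lemma eval_Sigma2_nonneg: "\<sigma> \<in> Sigma2 k \<Longrightarrow> 0 \<le> eval \<sigma> x"
  by (auto simp: Sigma2_def eval_simps intro!: sum_nonneg)

lemma Sigma2_mono: "k1 \<le> k2 \<Longrightarrow> Sigma2 k1 \<subseteq> Sigma2 k2"
  by (auto simp: Sigma2_def)

lemma square_in_Sigma2:
  assumes "deg q \<le> k"
  shows "q\<^sup>2 \<in> Sigma2 k"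
proof -
  have "\<exists>(r::nat) p. q\<^sup>2 = (\<Sum>l<r. (p l)\<^sup>2)"
    by (intro exI[of _ 1] exI[of _ "\<lambda>_. q"]) simp
  then show ?thesis
    using deg_power_le[OF assms, of 2] by (simp add: Sigma2_def)
qed

text \<open>The level enters only through the test set \<open>Sigma2\<close>, which grows with it,
  so the dual cone shrinks.\<close>

lemma Lambda_antimono:
  assumes "k1 \<le> k2"
  shows "Lambda d s \<phi> p \<nu> Y R k2 \<subseteq> Lambda d s \<phi> p \<nu> Y R k1"
proof -
  have "P_cone (deg_y p) \<nu> Y k2 \<subseteq> P_cone (deg_y p) \<nu> Y k1"
    using Sigma2_mono[OF assms] by (auto simp: P_cone_def)
  then show ?thesis
    unfolding Lambda_def by fast
qed

text \<open>Evaluation at x is an admissible functional with mean point x: it is nonnegative on sums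
  of squares, and \<open>apply_x\<close> turns p into p(x, y), which is nonpositive on Y.\<close>

lemma feasible_subset_Lambda: "feasible s \<phi> p Y \<inter> cball 0 R \<subseteq> Lambda d s \<phi> p \<nu> Y R k"
proof
  fix x assume x: "x \<in> feasible s \<phi> p Y \<inter> cball 0 R"
  define L where "L = (\<lambda>q. eval q x)"
  have "(\<Sum>i\<in>UNIV. (x $ i)\<^sup>2) = (norm x)\<^sup>2"
    by (rule power2_norm_vec[symmetric])
  also have "\<dots> \<le> R\<^sup>2"
    using x by (intro power_mono) auto
  finally have ball: "(\<Sum>i\<in>UNIV. (x $ i)\<^sup>2) \<le> R\<^sup>2" .
  have "- apply_x L p \<in> P_cone (deg_y p) \<nu> Y k"
  proof -
    have "eval (apply_x L p) y \<le> 0" if "y \<in> Y" for y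
      using x that eval_apply_x[OF eval_functional, of p "deg_x p" x y] by (simp add: feasible_def L_def)
    then have "0 \<le> eval (- apply_x L p) y * eval \<sigma> y" if "y \<in> Y" "\<sigma> \<in> Sigma2 k" for y \<sigma>
      using that by (intro mult_nonneg_nonneg) (simp_all add: eval_simps eval_Sigma2_nonneg)
    \<comment> \<open>The integrand is nonnegative, being cut off to 0 outside Y; if it is not
      integrable, the integral is 0 by convention.\<close>
    then have "0 \<le> (LINT y:Y|\<nu>. eval (- apply_x L p) y * eval \<sigma> y)" if "\<sigma> \<in> Sigma2 k" for \<sigma>
      unfolding set_lebesgue_integral_def using that
      by (intro Bochner_Integration.integral_nonneg) (simp add: indicator_def)
    then show ?thesis
      by (simp add: P_cone_def polys_le_def deg_apply_x_le)
  qed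
  moreover have "L \<in> functionals (2 * d)"
    by (simp add: L_def eval_functional)
  moreover have "\<forall>\<sigma>\<in>Sigma2 d. 0 \<le> L \<sigma>"
    by (simp add: L_def eval_Sigma2_nonneg)
  moreover have "\<forall>\<sigma>\<in>Sigma2 (d - 1). 0 \<le> L ((const (R\<^sup>2) - (\<Sum>i\<in>UNIV. (var i)\<^sup>2)) * \<sigma>)"
    using ball by (simp add: L_def eval_simps eval_Sigma2_nonneg)
  moreover have "L 1 = 1"
    by (simp add: L_def eval_simps)
  moreover have "\<forall>j\<in>{1..s}. L (\<phi> j) \<le> 0"
    using x by (simp add: L_def feasible_def)
  moreover have "x = mean_point L"
    by (simp add: mean_point_def L_def eval_simps)
  ultimately show "x \<in> Lambda d s \<phi> p \<nu> Y R k"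
    unfolding Lambda_def by blast
qed

text \<open>Testing the ball constraint with \<sigma> = 1 bounds the sum of the second moments by
  R^2, and second moments dominate squared means.\<close>

lemma Lambda_subset_cball:
  assumes "d \<ge> 1" "R > 0"
  shows "Lambda d s \<phi> p \<nu> Y R k \<subseteq> cball (0 :: real ^ ('m::finite)) R"
proof
  fix x assume "x \<in> Lambda d s \<phi> p \<nu> Y R k"
  then obtain L where x: "x = mean_point L" and L: "L \<in> functionals (2 * d)"
    and pos: "\<And>\<sigma>. \<sigma> \<in> Sigma2 d \<Longrightarrow> 0 \<le> L \<sigma>"
    and ball: "\<And>\<sigma>. \<sigma> \<in> Sigma2 (d - 1) \<Longrightarrow> 0 \<le> L ((const (R\<^sup>2) - (\<Sum>i\<in>UNIV. (var i)\<^sup>2)) * \<sigma>)"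
    and L1: "L 1 = 1"
    unfolding Lambda_def by blast
  have deg_var: "deg (var i :: 'm rpoly) \<le> 2 * d" for i
    using deg_var_le[of i] assms by linarith
  have deg_sq: "deg ((var i)\<^sup>2 :: 'm rpoly) \<le> 2 * d" for i
    using deg_power_le[OF deg_var_le[of i], of 2] assms by linarith
  have sq: "(L (var i))\<^sup>2 \<le> L ((var i)\<^sup>2)" for i
  proof -
    \<comment> \<open>The variance argument: for c the mean, the value of L at the square of
      \<open>var i - const c\<close> is the second moment minus c^2.\<close>
    define c where "c = L (var i)"
    have "(var i + const (- c))\<^sup>2 \<in> Sigma2 d"
      using assms deg_add_le[OF deg_var_le[of i], of "const (- c)"]
      by (intro square_in_Sigma2) simp
    then have "0 \<le> L ((var i + const (- c))\<^sup>2)"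
      by (rule pos)
    also have "(var i + const (- c))\<^sup>2 = (var i)\<^sup>2 + (const (- 2 * c) * var i + const (c\<^sup>2))"
    proof -
      have two: "const (- 2 * c) = const (- c) + (const (- c) :: 'm rpoly)"
        and sq: "const (c\<^sup>2) = const (- c) * (const (- c) :: 'm rpoly)"
        by (simp_all add: power2_eq_square flip: const_add const_mult)
      show ?thesis
        unfolding two sq by (simp add: power2_eq_square algebra_simps)
    qed
    also have "L \<dots> = L ((var i)\<^sup>2) + (- 2 * c * L (var i) + c\<^sup>2)"
    proof -
      have deg: "deg (const (- 2 * c) * var i :: 'm rpoly) \<le> 2 * d"
        using deg_mult_le[OF order.refl[of "deg (const (- 2 * c) :: 'm rpoly)"] deg_var[of i]] by simp
      have "L ((var i)\<^sup>2 + (const (- 2 * c) * var i + const (c\<^sup>2)))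
          = L ((var i)\<^sup>2) + (L (const (- 2 * c) * var i) + L (const (c\<^sup>2)))"
        using deg by (simp add: functionals_add[OF L] deg_sq deg_add_le)
      then show ?thesis
        using L1 by (simp only: functionals_scale[OF L deg_var] functionals_const[OF L])
    qed
    finally show ?thesis
      by (simp add: c_def power2_eq_square)
  qed
  have "1 \<in> Sigma2 (d - 1)"
    using square_in_Sigma2[of 1 "d - 1"] by simp
  then have "0 \<le> L (const (R\<^sup>2) - (\<Sum>i\<in>UNIV. (var i)\<^sup>2))"
    using ball[of 1] by simp
  also have "\<dots> = R\<^sup>2 - (\<Sum>i\<in>UNIV. L ((var i)\<^sup>2))"
    by (simp add: functionals_diff[OF L] functionals_sum[OF L] functionals_const[OF L] deg_sq deg_sum_le L1)
  finally have "(\<Sum>i\<in>UNIV. L ((var i)\<^sup>2)) \<le> R\<^sup>2"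
    by simp
  then have "(\<Sum>i\<in>UNIV. (L (var i))\<^sup>2) \<le> R\<^sup>2"
    using sum_mono[OF sq] by (rule order.trans[rotated])
  then have "(norm x)\<^sup>2 \<le> R\<^sup>2"
    by (simp add: x mean_point_def power2_norm_vec)
  then show "x \<in> cball 0 R"
    using assms power2_le_imp_le[of "norm x" R] by simp
qed

text \<open>The functional may change with k. Each test square picks a level high enough to contain
  it, and Jensen replaces the values of that functional by p(x, y), in which k no longer
  occurs.\<close>

lemma Inter_Lambda_subset_feasible:
  fixes p :: "('m::finite, 'n::finite) rpoly2"
  assumes d: "d \<ge> 1" and deg_p: "deg_x p \<le> 2 * d"
    and deg_\<phi>: "\<And>j. j \<in> {1..s} \<Longrightarrow> deg (\<phi> j) \<le> 2 * d"
    and Y: "compact Y"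
    and conv_\<phi>: "\<forall>j\<in>{1..s}. sos_convex (\<phi> j)" and conv_p: "\<forall>y\<in>Y. sos_convex (at_y p y)"
    and \<nu>: "sets \<nu> = sets borel" "finite_measure \<nu>" "measure_support \<nu> = Y"
  shows "(\<Inter>k\<in>{1..}. Lambda d s \<phi> p \<nu> Y R k) \<subseteq> feasible s \<phi> p Y"
proof
  fix x assume "x \<in> (\<Inter>k\<in>{1..}. Lambda d s \<phi> p \<nu> Y R k)"
  then have mem: "x \<in> Lambda d s \<phi> p \<nu> Y R k" if "k \<ge> 1" for k
    using that by blast
  \<comment> \<open>The bound on k stands inside the existential so that a total choice function can
    be extracted.\<close>
  have "\<forall>k. \<exists>L. k \<ge> 1 \<longrightarrow> x = mean_point L \<and> L \<in> functionals (2 * d) \<and> (\<forall>\<sigma>\<in>Sigma2 d. 0 \<le> L \<sigma>) \<and>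
      L 1 = 1 \<and> - apply_x L p \<in> P_cone (deg_y p) \<nu> Y k \<and> (\<forall>j\<in>{1..s}. L (\<phi> j) \<le> 0)"
    using mem unfolding Lambda_def mem_Collect_eq by meson
  from choice[OF this] obtain L where "\<forall>k\<ge>1. x = mean_point (L k) \<and>
      L k \<in> functionals (2 * d) \<and> (\<forall>\<sigma>\<in>Sigma2 d. 0 \<le> L k \<sigma>) \<and> L k 1 = 1 \<and>
      - apply_x (L k) p \<in> P_cone (deg_y p) \<nu> Y k \<and> (\<forall>j\<in>{1..s}. L k (\<phi> j) \<le> 0)"
    by blast
  then have x: "\<And>k. k \<ge> 1 \<Longrightarrow> x = mean_point (L k)"
    and L: "\<And>k. k \<ge> 1 \<Longrightarrow> L k \<in> functionals (2 * d)"
    and pos: "\<And>k \<sigma>. k \<ge> 1 \<Longrightarrow> \<sigma> \<in> Sigma2 d \<Longrightarrow> 0 \<le> L k \<sigma>"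
    and L1: "\<And>k. k \<ge> 1 \<Longrightarrow> L k 1 = 1"
    and cone: "\<And>k. k \<ge> 1 \<Longrightarrow> - apply_x (L k) p \<in> P_cone (deg_y p) \<nu> Y k"
    and L_\<phi>: "\<And>k j. k \<ge> 1 \<Longrightarrow> j \<in> {1..s} \<Longrightarrow> L k (\<phi> j) \<le> 0"
    by blast+
  have jensen: "eval h x \<le> L k h" if "k \<ge> 1" "deg h \<le> 2 * d" "sos_convex h" for h k
    unfolding x[OF that(1)]
    by (rule jensen_sos_convex[OF L[OF that(1)] pos[OF that(1)] L1[OF that(1)] d that(2,3)])
  define P where "P = apply_x (\<lambda>q. eval q x) p"
  have P: "eval P y = eval (at_y p y) x" for y
    unfolding P_def by (rule eval_apply_x[OF eval_functional deg_p])
  have sq: "0 \<le> (LINT y:Y|\<nu>. - eval P y * (eval q y)\<^sup>2)" for q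
  proof -
    \<comment> \<open>The level must admit the square of q, and the intersection starts at level
      1.\<close>
    define k where "k = max 1 (deg q)"
    have k: "k \<ge> 1"
      by (simp add: k_def)
    have "q\<^sup>2 \<in> Sigma2 k"
      by (intro square_in_Sigma2) (simp add: k_def)
    then have "0 \<le> (LINT y:Y|\<nu>. eval (- apply_x (L k) p) y * eval (q\<^sup>2) y)"
      using cone[OF k] by (simp add: P_cone_def)
    also have "\<dots> \<le> (LINT y:Y|\<nu>. - eval P y * (eval q y)\<^sup>2)"
    proof (intro set_integral_mono set_integrable_compact \<nu> Y continuous_intros continuous_on_eval)
      fix y assume "y \<in> Y"
      then have "eval P y \<le> L k (at_y p y)"
        unfolding P using k conv_p deg_p deg_at_y_le[of p y] by (intro jensen) auto
      also have "L k (at_y p y) = eval (apply_x (L k) p) y"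
        by (rule eval_apply_x[OF L[OF k] deg_p, symmetric])
      finally show "eval (- apply_x (L k) p) y * eval (q\<^sup>2) y \<le> - eval P y * (eval q y)\<^sup>2"
        unfolding eval_simps by (intro mult_right_mono) auto
    qed
    finally show ?thesis .
  qed
  have "0 \<le> - eval P y" if "y \<in> Y" for y
    by (rule nonneg_on_support[OF \<nu>(2,1,3) Y _ sq that]) (intro continuous_intros continuous_on_eval)
  \<comment> \<open>These constraints are the same at every level, so level 1 suffices.\<close>
  moreover have "eval (\<phi> j) x \<le> 0" if "j \<in> {1..s}" for j
    using jensen[of 1 "\<phi> j"] L_\<phi>[of 1 j] deg_\<phi> conv_\<phi> that by fastforce
  ultimately show "x \<in> feasible s \<phi> p Y"
    by (auto simp: feasible_def P)
qed

theorem theorem3p2: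
  fixes f g :: "('m::finite) rpoly"
    and s :: nat
    and \<phi> :: "nat \<Rightarrow> 'm rpoly"
    and p :: "('m, 'n::finite) rpoly2"
    and Y :: "(real ^ 'n) set"
    and \<nu> :: "(real ^ 'n) measure"
    and R gstar :: real
    and d :: nat
    and K :: "(real ^ 'm) set"
    and \<Lambda> :: "nat \<Rightarrow> (real ^ 'm) set"
  assumes K_def: "K = feasible s \<phi> p Y"
    and d_def: "d = half_deg f g s \<phi> p"
    and \<Lambda>_def: "\<Lambda> = Lambda d s \<phi> p \<nu> Y R"
    and d_pos: "d \<ge> 1"
    and S_nonempty: "optimal f g K \<noteq> {}"
    and Y_box: "Y \<subseteq> {y. \<forall>i. -1 \<le> y $ i \<and> y $ i \<le> 1}"
    and Y_closed: "closed Y"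
    and \<phi>_sos_convex: "\<forall>j\<in>{1..s}. sos_convex (\<phi> j)"
    and p_sos_convex: "\<forall>y\<in>Y. sos_convex (at_y p y)"
    and \<nu>_borel: "sets \<nu> = sets borel"
    and \<nu>_finite: "finite_measure \<nu>"
    and \<nu>_support: "measure_support \<nu> = Y"
    and R_pos: "R > 0"
    and gstar_pos: "gstar > 0"
    and bounds: "\<exists>u\<in>optimal f g K. norm u \<le> R \<and> eval g u \<ge> gstar"
  shows "(\<forall>k1 k2. k1 < k2 \<longrightarrow>
            K \<inter> cball 0 R \<subseteq> \<Lambda> k2 \<and> \<Lambda> k2 \<subseteq> \<Lambda> k1 \<and> \<Lambda> k1 \<subseteq> cball 0 R) \<and>
         K \<inter> cball 0 R = (\<Inter>k\<in>{1..}. \<Lambda> k) \<and>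
         (compact K \<and> K \<subseteq> cball 0 R \<longrightarrow> K = (\<Inter>k\<in>{1..}. \<Lambda> k))"
proof -
  \<comment> \<open>Rounding up in \<open>half_deg\<close> makes 2 * d at least every degree
    involved, so the functionals are linear on all constraint polynomials.\<close>
  have deg_bound: "k \<le> 2 * d" if "k \<in> {deg f, deg g, deg_x p} \<union> (\<lambda>j. deg (\<phi> j)) ` {1..s}" for k
  proof -
    have "k \<le> Max ({deg f, deg g, deg_x p} \<union> (\<lambda>j. deg (\<phi> j)) ` {1..s})"
      using that by (intro Max_ge) auto
    then have "real k / 2 \<le> real d"
      unfolding d_def half_deg_def by linarith
    then show ?thesis
      by linarith
  qed
  have "bounded Y"
    using Y_box by (intro bounded_subset[OF bounded_cbox[of "\<chi> i. -1" "\<chi> i. 1"]]) (auto simp: mem_box_cart)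
  then have "compact Y"
    using Y_closed by (simp add: compact_eq_bounded_closed)
  then have "(\<Inter>k\<in>{1..}. \<Lambda> k) \<subseteq> K"
    unfolding \<Lambda>_def K_def using d_pos \<phi>_sos_convex p_sos_convex \<nu>_borel \<nu>_finite \<nu>_support
    by (intro Inter_Lambda_subset_feasible) (auto intro!: deg_bound)
  moreover have sub: "K \<inter> cball 0 R \<subseteq> \<Lambda> k" for k
    unfolding K_def \<Lambda>_def by (rule feasible_subset_Lambda)
  moreover have ball: "\<Lambda> k \<subseteq> cball 0 R" for k
    unfolding \<Lambda>_def using d_pos R_pos by (rule Lambda_subset_cball)
  \<comment> \<open>The index set contains 1, so the ball that bounds each \<Lambda> k also bounds
    the intersection.\<close>
  ultimately have Inter: "K \<inter> cball 0 R = (\<Inter>k\<in>{1..}. \<Lambda> k)"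
    by (fastforce simp del: mem_cball)
  have anti: "\<Lambda> k2 \<subseteq> \<Lambda> k1" if "k1 < k2" for k1 k2
    unfolding \<Lambda>_def using that by (intro Lambda_antimono) simp
  have "K = (\<Inter>k\<in>{1..}. \<Lambda> k)" if "K \<subseteq> cball 0 R"
    using Inter that by blast
  then show ?thesis
    using sub ball anti Inter by blast
qed

end
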